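(* The contact torsion $\tau_{ij}{}^k$ of any contact projective structure on a three-dimensional co-oriented contact manifold vanishes identically.
   Context: All objects are smooth. $(M,H)$ is a contact manifold of dimension $2n-1$ (here $n=2$). A contact one-form $\theta$ is a non-vanishing one-form annihilating $H$; its Reeb field $T$ satisfies $\theta(T)=1$, $i(T)d\theta=0$. A path is a smoothly immersed one-dimensional submanifold; a contact path is one everywhere tangent to $H$. A contact projective structure is a $(4n-5)$-parameter family of contact paths (contact geodesics) such that for each $x\in M$ and one-dimensional $L\subset H_x$ there is a unique path of the family through $x$ tangent to $L$, and the paths are among the unparameterized geodesics of some affine connection (torsion allowed). For each $\theta$ there is a unique affine connection $\nabla$, with torsion $\tau$, having the contact geodesics among its unparameterized geodesics and such that $\nabla\theta=0$, $\nabla d\theta=0$, $i(T)\tau=0$ and the trace of $\tau$ (the one-form $Y\mapsto\mathrm{tr}(X\mapsto\tau(Y,X))$) is zero. The contact torsion is the section $\tau_{ij}{}^k$ of $\Lambda^2(H^* )\otimes H$ obtained by restricting $\tau$ to $H\times H$ and projecting to $H$ along $T$; it does not depend on $\theta$. *)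

theory Defs
  imports "HOL-Analysis.Analysis"
begin

text \<open>
  Smooth manifolds are topological spaces with a smooth atlas.  A tensor-like object on the manifold
  is a family of components, one for each chart \<open>c\<close> of the atlas and each point \<open>p\<close> of the domain
  of \<open>c\<close>, subject to the usual transformation law under change of charts.  Values at charts outside
  the atlas, or at points outside the domain of the chart, carry no meaning.
\<close>

section \<open>Smooth maps between open sets of Euclidean spaces\<close>

primrec Ck_on ::
  "nat \<Rightarrow> 'a::euclidean_space set \<Rightarrow> ('a \<Rightarrow> 'b::real_normed_vector) \<Rightarrow> bool" where
  "Ck_on 0 S f \<longleftrightarrow> continuous_on S f"
| "Ck_on (Suc k) S f \<longleftrightarrow>
     (\<forall>x\<in>S. f differentiable (at x)) \<and> (\<forall>v. Ck_on k S (\<lambda>x. frechet_derivative f (at x) v))"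

text \<open>Only used for open \<open>S\<close>.\<close>

definition smooth_on :: "'a::euclidean_space set \<Rightarrow> ('a \<Rightarrow> 'b::real_normed_vector) \<Rightarrow> bool" where
  "smooth_on S f \<longleftrightarrow> (\<forall>k. Ck_on k S f)"


section \<open>Smooth manifolds\<close>

type_synonym ('a, 'n) chart = "'a set \<times> ('a \<Rightarrow> real ^ 'n)"

abbreviation dom_chart :: "('a, 'n) chart \<Rightarrow> 'a set" where
  "dom_chart c \<equiv> fst c"

abbreviation coords :: "('a, 'n) chart \<Rightarrow> 'a \<Rightarrow> real ^ 'n" where
  "coords c \<equiv> snd c"

definition inv_chart :: "('a, 'n) chart \<Rightarrow> real ^ 'n \<Rightarrow> 'a" where
  "inv_chart c = inv_into (dom_chart c) (coords c)"

definition transition :: "('a, 'n) chart \<Rightarrow> ('a, 'n) chart \<Rightarrow> real ^ 'n \<Rightarrow> real ^ 'n" where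
  "transition c d = coords d \<circ> inv_chart c"

definition smooth_manifold :: "'a topology \<Rightarrow> ('a, 'n::finite) chart set \<Rightarrow> bool" where
  "smooth_manifold M A \<longleftrightarrow>
     Hausdorff_space M \<and> second_countable M \<and>
     (\<forall>c\<in>A. openin M (dom_chart c) \<and> open (coords c ` dom_chart c) \<and>
        homeomorphic_map (subtopology M (dom_chart c)) (top_of_set (coords c ` dom_chart c))
          (coords c)) \<and>
     (\<Union>c\<in>A. dom_chart c) = topspace M \<and>
     (\<forall>c\<in>A. \<forall>d\<in>A. smooth_on (coords c ` (dom_chart c \<inter> dom_chart d)) (transition c d))"

text \<open>First and second derivative at \<open>p\<close> of the change of coordinates from \<open>c\<close> to \<open>d\<close>.\<close>

definition jac ::
  "('a, 'n::finite) chart \<Rightarrow> ('a, 'n) chart \<Rightarrow> 'a \<Rightarrow> real ^ 'n \<Rightarrow> real ^ 'n" where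
  "jac c d p = frechet_derivative (transition c d) (at (coords c p))"

definition hess ::
  "('a, 'n::finite) chart \<Rightarrow> ('a, 'n) chart \<Rightarrow> 'a \<Rightarrow> real ^ 'n \<Rightarrow> real ^ 'n \<Rightarrow> real ^ 'n" where
  "hess c d p v w =
     frechet_derivative (\<lambda>u. frechet_derivative (transition c d) (at u) w) (at (coords c p)) v"

text \<open>Smoothness near a point, and directional derivatives, of a map read in the chart \<open>c\<close>.\<close>

definition smooth_in ::
  "('a, 'n::finite) chart \<Rightarrow> 'a set \<Rightarrow> ('a \<Rightarrow> 'b::real_normed_vector) \<Rightarrow> bool" where
  "smooth_in c W f \<longleftrightarrow> smooth_on (coords c ` W) (f \<circ> inv_chart c)"

definition dir_deriv ::
  "('a, 'n::finite) chart \<Rightarrow> ('a \<Rightarrow> 'b::real_normed_vector) \<Rightarrow> 'a \<Rightarrow> real ^ 'n \<Rightarrow> 'b" where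
  "dir_deriv c f p v = frechet_derivative (f \<circ> inv_chart c) (at (coords c p)) v"


section \<open>Vector fields, forms and affine connections\<close>

definition vector_field ::
  "('a, 'n::finite) chart set \<Rightarrow> (('a, 'n) chart \<Rightarrow> 'a \<Rightarrow> real ^ 'n) \<Rightarrow> bool" where
  "vector_field A Y \<longleftrightarrow>
     (\<forall>c\<in>A. smooth_in c (dom_chart c) (Y c)) \<and>
     (\<forall>c\<in>A. \<forall>d\<in>A. \<forall>p\<in>dom_chart c \<inter> dom_chart d. Y d p = jac c d p (Y c p))"

text \<open>A smooth one-form on the open subset \<open>W\<close> of the domain of the chart \<open>c\<close>.\<close>

definition local_one_form ::
  "('a, 'n::finite) chart \<Rightarrow> 'a set \<Rightarrow> ('a \<Rightarrow> real ^ 'n \<Rightarrow> real) \<Rightarrow> bool" where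
  "local_one_form c W \<alpha> \<longleftrightarrow>
     (\<forall>p\<in>W. linear (\<alpha> p)) \<and> (\<forall>v. smooth_in c W (\<lambda>p. \<alpha> p v))"

definition one_form ::
  "('a, 'n::finite) chart set \<Rightarrow> (('a, 'n) chart \<Rightarrow> 'a \<Rightarrow> real ^ 'n \<Rightarrow> real) \<Rightarrow> bool" where
  "one_form A \<theta> \<longleftrightarrow>
     (\<forall>c\<in>A. local_one_form c (dom_chart c) (\<theta> c)) \<and>
     (\<forall>c\<in>A. \<forall>d\<in>A. \<forall>p\<in>dom_chart c \<inter> dom_chart d. \<forall>v. \<theta> c p v = \<theta> d p (jac c d p v))"

text \<open>
  The exterior derivative, \<open>d\<alpha>(X,Y) = X(\<alpha>(Y)) - Y(\<alpha>(X)) - \<alpha>([X,Y])\<close>, evaluated on the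
  coordinate-constant vector fields \<open>v\<close> and \<open>w\<close>, which commute.
\<close>

definition ext_deriv ::
  "('a, 'n::finite) chart \<Rightarrow> ('a \<Rightarrow> real ^ 'n \<Rightarrow> real) \<Rightarrow> 'a \<Rightarrow> real ^ 'n \<Rightarrow> real ^ 'n \<Rightarrow> real" where
  "ext_deriv c \<alpha> p v w = dir_deriv c (\<lambda>q. \<alpha> q w) p v - dir_deriv c (\<lambda>q. \<alpha> q v) p w"

text \<open>
  An affine connection is given by its Christoffel symbols: \<open>\<Gamma> c p v w\<close> is the covariant derivative
  at \<open>p\<close>, along \<open>v\<close>, of the vector field with constant components \<open>w\<close> in the chart \<open>c\<close>; so in \<open>c\<close>
  the covariant derivative of \<open>Y\<close> along \<open>v\<close> is \<open>dir_deriv c (Y c) p v + \<Gamma> c p v (Y c p)\<close>.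
  The field that is constantly \<open>w\<close> in \<open>c\<close> has components \<open>jac c d q w\<close> in \<open>d\<close>, whence the
  second-derivative term in the transformation law.
\<close>

definition affine_connection ::
  "('a, 'n::finite) chart set \<Rightarrow>
   (('a, 'n) chart \<Rightarrow> 'a \<Rightarrow> real ^ 'n \<Rightarrow> real ^ 'n \<Rightarrow> real ^ 'n) \<Rightarrow> bool" where
  "affine_connection A \<Gamma> \<longleftrightarrow>
     (\<forall>c\<in>A. (\<forall>p\<in>dom_chart c. bilinear (\<Gamma> c p)) \<and>
            (\<forall>v w. smooth_in c (dom_chart c) (\<lambda>p. \<Gamma> c p v w))) \<and>
     (\<forall>c\<in>A. \<forall>d\<in>A. \<forall>p\<in>dom_chart c \<inter> dom_chart d. \<forall>v w.
        jac c d p (\<Gamma> c p v w) = hess c d p v w + \<Gamma> d p (jac c d p v) (jac c d p w))"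

text \<open>
  The torsion \<open>\<tau>(X,Y) = \<nabla>\<^sub>X Y - \<nabla>\<^sub>Y X - [X,Y]\<close>, again on coordinate-constant fields.
\<close>

definition torsion ::
  "(('a, 'n::finite) chart \<Rightarrow> 'a \<Rightarrow> real ^ 'n \<Rightarrow> real ^ 'n \<Rightarrow> real ^ 'n) \<Rightarrow>
   ('a, 'n) chart \<Rightarrow> 'a \<Rightarrow> real ^ 'n \<Rightarrow> real ^ 'n \<Rightarrow> real ^ 'n" where
  "torsion \<Gamma> c p v w = \<Gamma> c p v w - \<Gamma> c p w v"

text \<open>\<open>(\<nabla>\<^sub>v \<theta>)(w)\<close> for a one-form, and \<open>(\<nabla>\<^sub>v \<omega>)(w,z)\<close> for a covariant two-tensor.\<close>

definition cov_deriv1 where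
  "cov_deriv1 \<Gamma> \<theta> c p v w = dir_deriv c (\<lambda>q. \<theta> c q w :: real) p v - \<theta> c p (\<Gamma> c p v w)"

definition cov_deriv2 where
  "cov_deriv2 \<Gamma> \<omega> c p v w z =
     dir_deriv c (\<lambda>q. \<omega> c q w z :: real) p v - \<omega> c p (\<Gamma> c p v w) z - \<omega> c p w (\<Gamma> c p v z)"


section \<open>Contact structures\<close>

text \<open>\<open>\<alpha>\<close> is a local smooth one-form on \<open>W\<close> with kernel \<open>K\<close>.\<close>

definition local_defining_form ::
  "('a, 'n::finite) chart \<Rightarrow> 'a set \<Rightarrow> ('a \<Rightarrow> (real ^ 'n) set) \<Rightarrow> ('a \<Rightarrow> real ^ 'n \<Rightarrow> real) \<Rightarrow> bool" where
  "local_defining_form c W K \<alpha> \<longleftrightarrow>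
     local_one_form c W \<alpha> \<and> (\<forall>p\<in>W. K p = {v. \<alpha> p v = 0})"

definition contact_structure ::
  "'a topology \<Rightarrow> ('a, 'n::finite) chart set \<Rightarrow>
   (('a, 'n) chart \<Rightarrow> 'a \<Rightarrow> (real ^ 'n) set) \<Rightarrow> bool" where
  "contact_structure M A H \<longleftrightarrow>
     (\<forall>c\<in>A. \<forall>p\<in>dom_chart c. subspace (H c p) \<and> dim (H c p) + 1 = CARD('n)) \<and>
     (\<forall>c\<in>A. \<forall>d\<in>A. \<forall>p\<in>dom_chart c \<inter> dom_chart d. H d p = jac c d p ` H c p) \<and>
     (\<forall>c\<in>A. \<forall>p\<in>dom_chart c. \<exists>W \<alpha>. openin M W \<and> p \<in> W \<and> W \<subseteq> dom_chart c \<and>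
        local_defining_form c W (H c) \<alpha> \<and>
        (\<forall>q\<in>W. \<forall>v\<in>H c q. (\<forall>w\<in>H c q. ext_deriv c \<alpha> q v w = 0) \<longrightarrow> v = 0))"

text \<open>
  A co-orientation, that is, an orientation of the line bundle \<open>TM/H\<close>, is recorded by the set
  \<open>C c p\<close> of tangent vectors with positive image in the quotient.
\<close>

definition co_orientation ::
  "'a topology \<Rightarrow> ('a, 'n::finite) chart set \<Rightarrow> (('a, 'n) chart \<Rightarrow> 'a \<Rightarrow> (real ^ 'n) set) \<Rightarrow>
   (('a, 'n) chart \<Rightarrow> 'a \<Rightarrow> (real ^ 'n) set) \<Rightarrow> bool" where
  "co_orientation M A H C \<longleftrightarrow>
     (\<forall>c\<in>A. \<forall>d\<in>A. \<forall>p\<in>dom_chart c \<inter> dom_chart d. C d p = jac c d p ` C c p) \<and>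
     (\<forall>c\<in>A. \<forall>p\<in>dom_chart c. \<exists>W \<alpha>. openin M W \<and> p \<in> W \<and> W \<subseteq> dom_chart c \<and>
        local_defining_form c W (H c) \<alpha> \<and> (\<forall>q\<in>W. C c q = {v. 0 < \<alpha> q v}))"

definition contact_form ::
  "('a, 'n::finite) chart set \<Rightarrow> (('a, 'n) chart \<Rightarrow> 'a \<Rightarrow> (real ^ 'n) set) \<Rightarrow>
   (('a, 'n) chart \<Rightarrow> 'a \<Rightarrow> real ^ 'n \<Rightarrow> real) \<Rightarrow> bool" where
  "contact_form A H \<theta> \<longleftrightarrow>
     one_form A \<theta> \<and>
     (\<forall>c\<in>A. \<forall>p\<in>dom_chart c. (\<exists>v. \<theta> c p v \<noteq> 0) \<and> (\<forall>v\<in>H c p. \<theta> c p v = 0))"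

definition reeb_field ::
  "('a, 'n::finite) chart set \<Rightarrow> (('a, 'n) chart \<Rightarrow> 'a \<Rightarrow> real ^ 'n \<Rightarrow> real) \<Rightarrow>
   (('a, 'n) chart \<Rightarrow> 'a \<Rightarrow> real ^ 'n) \<Rightarrow> bool" where
  "reeb_field A \<theta> T \<longleftrightarrow>
     vector_field A T \<and>
     (\<forall>c\<in>A. \<forall>p\<in>dom_chart c.
        \<theta> c p (T c p) = 1 \<and> (\<forall>v. ext_deriv c (\<theta> c) p (T c p) v = 0))"


section \<open>Paths and geodesics\<close>

text \<open>
  A path is given by an immersion \<open>\<gamma>\<close> of a nonempty open interval \<open>I\<close>; a closed path is given by
  an immersion running around it.  The path itself is the image \<open>\<gamma> ` I\<close>, so two immersions
  describe the same path if their images coincide.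
\<close>

type_synonym 'a curve = "real set \<times> (real \<Rightarrow> 'a)"

abbreviation path_of :: "'a curve \<Rightarrow> 'a set" where
  "path_of k \<equiv> snd k ` fst k"

definition velocity :: "('a, 'n::finite) chart \<Rightarrow> (real \<Rightarrow> 'a) \<Rightarrow> real \<Rightarrow> real ^ 'n" where
  "velocity c \<gamma> t = vector_derivative (coords c \<circ> \<gamma>) (at t)"

definition smooth_curve :: "'a topology \<Rightarrow> ('a, 'n::finite) chart set \<Rightarrow> 'a curve \<Rightarrow> bool" where
  "smooth_curve M A = (\<lambda>(I, \<gamma>).
     open I \<and> is_interval I \<and> I \<noteq> {} \<and> continuous_map (top_of_set I) M \<gamma> \<and>
     (\<forall>c\<in>A. smooth_on {t \<in> I. \<gamma> t \<in> dom_chart c} (coords c \<circ> \<gamma>)))"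

definition immersed_curve :: "'a topology \<Rightarrow> ('a, 'n::finite) chart set \<Rightarrow> 'a curve \<Rightarrow> bool" where
  "immersed_curve M A = (\<lambda>(I, \<gamma>).
     smooth_curve M A (I, \<gamma>) \<and>
     (\<forall>c\<in>A. \<forall>t\<in>I. \<gamma> t \<in> dom_chart c \<longrightarrow> velocity c \<gamma> t \<noteq> 0))"

definition contact_curve ::
  "'a topology \<Rightarrow> ('a, 'n::finite) chart set \<Rightarrow> (('a, 'n) chart \<Rightarrow> 'a \<Rightarrow> (real ^ 'n) set) \<Rightarrow>
   'a curve \<Rightarrow> bool" where
  "contact_curve M A H = (\<lambda>(I, \<gamma>).
     immersed_curve M A (I, \<gamma>) \<and>
     (\<forall>c\<in>A. \<forall>t\<in>I. \<gamma> t \<in> dom_chart c \<longrightarrow> velocity c \<gamma> t \<in> H c (\<gamma> t)))"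

text \<open>The curve passes through \<open>x\<close> and is there tangent to the line \<open>L\<close>, given in the chart \<open>c\<close>.\<close>

definition tangent_at :: "('a, 'n::finite) chart \<Rightarrow> 'a \<Rightarrow> (real ^ 'n) set \<Rightarrow> 'a curve \<Rightarrow> bool" where
  "tangent_at c x L = (\<lambda>(I, \<gamma>). \<exists>t\<in>I. \<gamma> t = x \<and> velocity c \<gamma> t \<in> L)"

definition geodesic ::
  "'a topology \<Rightarrow> ('a, 'n::finite) chart set \<Rightarrow>
   (('a, 'n) chart \<Rightarrow> 'a \<Rightarrow> real ^ 'n \<Rightarrow> real ^ 'n \<Rightarrow> real ^ 'n) \<Rightarrow> 'a curve \<Rightarrow> bool" where
  "geodesic M A \<Gamma> = (\<lambda>(I, \<gamma>).
     smooth_curve M A (I, \<gamma>) \<and>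
     (\<forall>c\<in>A. \<forall>t\<in>I. \<gamma> t \<in> dom_chart c \<longrightarrow>
        vector_derivative (velocity c \<gamma>) (at t)
          + \<Gamma> c (\<gamma> t) (velocity c \<gamma> t) (velocity c \<gamma> t) = 0))"

definition unparam_geodesic ::
  "'a topology \<Rightarrow> ('a, 'n::finite) chart set \<Rightarrow>
   (('a, 'n) chart \<Rightarrow> 'a \<Rightarrow> real ^ 'n \<Rightarrow> real ^ 'n \<Rightarrow> real ^ 'n) \<Rightarrow> 'a curve \<Rightarrow> bool" where
  "unparam_geodesic M A \<Gamma> = (\<lambda>(I, \<gamma>).
     immersed_curve M A (I, \<gamma>) \<and>
     (\<exists>s \<sigma>. smooth_on I s \<and> (\<forall>t\<in>I. deriv s t \<noteq> 0) \<and> geodesic M A \<Gamma> (s ` I, \<sigma>) \<and>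
        (\<forall>t\<in>I. \<gamma> t = \<sigma> (s t))))"


section \<open>Contact projective structures and contact torsion\<close>

text \<open>
  That the paths depend on \<open>4n - 5\<close> parameters is not a separate condition: in dimension \<open>2n - 1\<close>
  the contact directions form a manifold of dimension \<open>4n - 4\<close>, and by the conditions below the
  paths lift to a smooth foliation of it by curves.
\<close>

definition contact_projective_structure ::
  "'a topology \<Rightarrow> ('a, 'n::finite) chart set \<Rightarrow> (('a, 'n) chart \<Rightarrow> 'a \<Rightarrow> (real ^ 'n) set) \<Rightarrow>
   'a curve set \<Rightarrow> bool" where
  "contact_projective_structure M A H P \<longleftrightarrow>
     (\<forall>k\<in>P. contact_curve M A H k) \<and>
     (\<forall>c\<in>A. \<forall>x\<in>dom_chart c. \<forall>L. subspace L \<and> dim L = 1 \<and> L \<subseteq> H c x \<longrightarrow>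
        (\<exists>!N. N \<in> path_of ` {k \<in> P. tangent_at c x L k})) \<and>
     (\<exists>\<Gamma>. affine_connection A \<Gamma> \<and> (\<forall>k\<in>P. unparam_geodesic M A \<Gamma> k))"

text \<open>The connection associated with a contact one-form \<open>\<theta>\<close> with Reeb field \<open>T\<close>.\<close>

definition adapted_connection ::
  "'a topology \<Rightarrow> ('a, 'n::finite) chart set \<Rightarrow> 'a curve set \<Rightarrow>
   (('a, 'n) chart \<Rightarrow> 'a \<Rightarrow> real ^ 'n \<Rightarrow> real) \<Rightarrow> (('a, 'n) chart \<Rightarrow> 'a \<Rightarrow> real ^ 'n) \<Rightarrow>
   (('a, 'n) chart \<Rightarrow> 'a \<Rightarrow> real ^ 'n \<Rightarrow> real ^ 'n \<Rightarrow> real ^ 'n) \<Rightarrow> bool" where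
  "adapted_connection M A P \<theta> T \<Gamma> \<longleftrightarrow>
     affine_connection A \<Gamma> \<and>
     (\<forall>k\<in>P. unparam_geodesic M A \<Gamma> k) \<and>
     (\<forall>c\<in>A. \<forall>p\<in>dom_chart c.
        (\<forall>v w. cov_deriv1 \<Gamma> \<theta> c p v w = 0) \<and>
        (\<forall>v w z. cov_deriv2 \<Gamma> (\<lambda>c. ext_deriv c (\<theta> c)) c p v w z = 0) \<and>
        (\<forall>v. torsion \<Gamma> c p (T c p) v = 0) \<and>
        (\<forall>v. trace (matrix (\<lambda>w. torsion \<Gamma> c p v w)) = 0))"

text \<open>
  The torsion composed with the projection onto \<open>H = ker \<theta>\<close> along \<open>T\<close>; the contact torsion is the
  restriction of this to \<open>v, w \<in> H\<close>.
\<close>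

definition contact_torsion ::
  "(('a, 'n::finite) chart \<Rightarrow> 'a \<Rightarrow> real ^ 'n \<Rightarrow> real) \<Rightarrow> (('a, 'n) chart \<Rightarrow> 'a \<Rightarrow> real ^ 'n) \<Rightarrow>
   (('a, 'n) chart \<Rightarrow> 'a \<Rightarrow> real ^ 'n \<Rightarrow> real ^ 'n \<Rightarrow> real ^ 'n) \<Rightarrow>
   ('a, 'n) chart \<Rightarrow> 'a \<Rightarrow> real ^ 'n \<Rightarrow> real ^ 'n \<Rightarrow> real ^ 'n" where
  "contact_torsion \<theta> T \<Gamma> c p v w =
     torsion \<Gamma> c p v w - \<theta> c p (torsion \<Gamma> c p v w) *\<^sub>R T c p"

end

theory Submission
  imports Defs
begin

text \<open>
  The statement is pointwise linear algebra.  Fix a point and write \<open>\<tau>\<close> for the torsion there, an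
  alternating bilinear map on a three-dimensional space with \<open>\<tau>(T, \<cdot>) = 0\<close>.  A trace-free element of
  \<open>\<Lambda>\<^sup>2(H\<^sup>*) \<otimes> H\<close> has to vanish when \<open>H\<close> is a plane, because there the trace
  \<open>\<Lambda>\<^sup>2(H\<^sup>*) \<otimes> H \<rightarrow> H\<^sup>*\<close> is an isomorphism.  Concretely, let \<open>v, w\<close> be a basis of \<open>H = ker \<theta>\<close> and
  put \<open>u = \<tau>(v, w)\<close>.  The endomorphism \<open>\<tau>(v, \<cdot>)\<close> kills \<open>v\<close> and \<open>T\<close> and sends \<open>w\<close> to \<open>u\<close>, so it has
  rank at most one and its trace is the \<open>w\<close>-component of \<open>u\<close> in the basis \<open>v, w, T\<close>; likewise the
  trace of \<open>\<tau>(w, \<cdot>)\<close> is minus the \<open>v\<close>-component of \<open>u\<close>.  Both traces are zero, hence \<open>u\<close> is a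
  multiple of \<open>T\<close>, and the projection onto \<open>H\<close> along \<open>T\<close> sends it to zero.  Lemma
  \<open>trace_rank_one\<close> computes the traces, and \<open>alternating_trace_free_in_kernel_direction\<close> is the
  resulting statement about \<open>\<tau>\<close>.
\<close>

lemma trace_rank_one:
  fixes \<phi> :: "real ^ 'n::finite \<Rightarrow> real" and u :: "real ^ 'n"
  assumes "linear \<phi>"
  shows "trace (matrix (\<lambda>x. \<phi> x *\<^sub>R u)) = \<phi> u"
proof -
  have "\<phi> u = \<phi> (\<Sum>i\<in>UNIV. u $ i *\<^sub>R axis i 1)"
    using basis_expansion[of u] by (simp add: scalar_mult_eq_scaleR)
  also have "\<dots> = (\<Sum>i\<in>UNIV. u $ i * \<phi> (axis i 1))"
    using assms by (simp add: linear_sum linear_cmul)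
  finally show ?thesis
    by (simp add: trace_def matrix_def mult.commute)
qed

text \<open>
  The two trace conditions at \<open>v\<close> and \<open>w\<close> together with the form \<open>\<theta>\<close> determine the three
  coordinates of \<open>B v w\<close> in the basis \<open>v, w, T\<close>.
\<close>

lemma alternating_trace_free_in_kernel_direction:
  fixes B :: "real ^ 'n::finite \<Rightarrow> real ^ 'n \<Rightarrow> real ^ 'n"
    and \<theta> :: "real ^ 'n \<Rightarrow> real"
  assumes dim3: "CARD('n) = 3"
    and B: "bilinear B" and alt: "\<And>x. B x x = 0"
    and T: "\<And>x. B T x = 0" and tr: "\<And>x. trace (matrix (B x)) = 0"
    and \<theta>: "linear \<theta>" "\<theta> T = 1" "\<theta> v = 0" "\<theta> w = 0"
  shows "B v w = \<theta> (B v w) *\<^sub>R T"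
proof (cases "v = 0 \<or> w \<in> span {v}")
  case True
  then have "B v w = 0"
    using alt bilinear_lzero[OF B] bilinear_rmul[OF B] by (auto simp: span_singleton)
  then show ?thesis
    using linear_0[OF \<theta>(1)] by simp
next
  case False
  have skew: "B x y = - B y x" for x y
    using alt[of "x + y"] alt[of x] alt[of y]
    by (simp add: bilinear_ladd[OF B] bilinear_radd[OF B] eq_neg_iff_add_eq_0 add.commute)
  have lin: "linear (B x)" for x
    using B by (simp add: bilinear_def)
  have T': "B x T = 0" for x
    using skew[of x T] T by simp
  have "span {w, v} \<subseteq> {x. \<theta> x = 0}"
    using \<theta> by (intro span_minimal) (auto simp: linear_subspace_kernel)
  then have "T \<notin> span {w, v}"
    using \<theta>(2) by auto
  with False have indep: "independent {T, w, v}"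
    and distinct: "w \<noteq> v" "T \<noteq> w" "T \<noteq> v"
    by (auto simp: independent_insert span_base)
  have basis: "x \<in> span {T, w, v}" for x
    using card_ge_dim_independent[OF subset_UNIV indep] dim3 distinct by auto
  define u where "u = B v w"
  \<comment> \<open>\<open>\<phi>\<close> and \<open>\<psi>\<close> are the \<open>w\<close>- and \<open>v\<close>-coordinates in this basis; \<open>\<theta>\<close> is already the \<open>T\<close>-coordinate.\<close>
  obtain \<phi> where \<phi>: "linear \<phi>" "\<phi> T = 0" "\<phi> v = 0" "\<phi> w = (1::real)"
    using linear_independent_extend[OF indep, of "\<lambda>x. if x = w then 1 else 0"] distinct by auto
  obtain \<psi> where \<psi>: "linear \<psi>" "\<psi> T = 0" "\<psi> w = 0" "\<psi> v = (1::real)"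
    using linear_independent_extend[OF indep, of "\<lambda>x. if x = v then 1 else 0"] distinct by auto
  have "B v x = \<phi> x *\<^sub>R u" for x
    by (rule linear_eq_on[OF lin _ basis])
       (use \<phi> alt T' in \<open>auto simp: u_def linear_iff scaleR_add_left\<close>)
  then have "B v = (\<lambda>x. \<phi> x *\<^sub>R u)"
    by blast
  then have "\<phi> u = 0"
    using tr[of v] trace_rank_one[OF \<phi>(1), of u] by simp
  have "B w x = \<psi> x *\<^sub>R (- u)" for x
    by (rule linear_eq_on[OF lin _ basis])
       (use \<psi> alt T' skew[of w v] in \<open>auto simp: u_def linear_iff scaleR_add_left\<close>)
  then have "B w = (\<lambda>x. \<psi> x *\<^sub>R (- u))"
    by blast
  then have "\<psi> u = 0"
    using tr[of w] trace_rank_one[OF \<psi>(1), of "- u"] linear_neg[OF \<psi>(1)] by simp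
  have "u = \<psi> u *\<^sub>R v + \<phi> u *\<^sub>R w + \<theta> u *\<^sub>R T"
    by (rule linear_eq_on[OF linear_ident _ basis])
       (use \<phi> \<psi> \<theta> in \<open>auto simp: linear_iff algebra_simps\<close>)
  with \<open>\<phi> u = 0\<close> \<open>\<psi> u = 0\<close> show ?thesis
    by (simp add: u_def)
qed

lemma bilinear_torsion:
  assumes "affine_connection A \<Gamma>" "c \<in> A" "p \<in> dom_chart c"
  shows "bilinear (torsion \<Gamma> c p)"
proof -
  have "bilinear (\<Gamma> c p)"
    using assms by (simp add: affine_connection_def)
  then show ?thesis
    unfolding bilinear_def torsion_def by (auto intro: linear_compose_sub)
qed

theorem proposition2p1:
  fixes M :: "'a topology"
    and A :: "('a, 3) chart set"
    and H C :: "('a, 3) chart \<Rightarrow> 'a \<Rightarrow> (real ^ 3) set"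
    and P :: "'a curve set"
    and \<theta> :: "('a, 3) chart \<Rightarrow> 'a \<Rightarrow> real ^ 3 \<Rightarrow> real"
    and T :: "('a, 3) chart \<Rightarrow> 'a \<Rightarrow> real ^ 3"
    and \<Gamma> :: "('a, 3) chart \<Rightarrow> 'a \<Rightarrow> real ^ 3 \<Rightarrow> real ^ 3 \<Rightarrow> real ^ 3"
  assumes "smooth_manifold M A"
    and "contact_structure M A H"
    and "co_orientation M A H C"
    and "contact_projective_structure M A H P"
    and "contact_form A H \<theta>"
    and "reeb_field A \<theta> T"
    and "adapted_connection M A P \<theta> T \<Gamma>"
  shows "\<forall>c\<in>A. \<forall>p\<in>dom_chart c. \<forall>v\<in>H c p. \<forall>w\<in>H c p. contact_torsion \<theta> T \<Gamma> c p v w = 0"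
proof (intro ballI)
  fix c p v w
  assume c: "c \<in> A" and p: "p \<in> dom_chart c" and vw: "v \<in> H c p" "w \<in> H c p"
  have "torsion \<Gamma> c p v w = \<theta> c p (torsion \<Gamma> c p v w) *\<^sub>R T c p"
  proof (rule alternating_trace_free_in_kernel_direction
      [where B = "torsion \<Gamma> c p" and \<theta> = "\<theta> c p"])
    show "bilinear (torsion \<Gamma> c p)"
      using assms(7) c p by (intro bilinear_torsion) (auto simp: adapted_connection_def)
    show "torsion \<Gamma> c p x x = 0" for x
      by (simp add: torsion_def)
    show "torsion \<Gamma> c p (T c p) x = 0" "trace (matrix (torsion \<Gamma> c p x)) = 0" for x
      using assms(7) c p by (simp_all add: adapted_connection_def)
    show "linear (\<theta> c p)"
      using assms(5) c p by (simp add: contact_form_def one_form_def local_one_form_def)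
    show "\<theta> c p (T c p) = 1"
      using assms(6) c p by (simp add: reeb_field_def)
    show "\<theta> c p v = 0" "\<theta> c p w = 0"
      using assms(5) c p vw by (simp_all add: contact_form_def)
  qed simp
  then show "contact_torsion \<theta> T \<Gamma> c p v w = 0"
    by (simp add: contact_torsion_def)
qed

end
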